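(* Let $(V,p)$ be an irreducible Markov chain on a finite state space $V$ whose transition function has symmetric support, and let $d$ be a general path distance on $V$ with respect to the induced graph $G$. Assume $G$ has non-negative Ollivier curvature and that there exists $x\in V$ with $\kappa(x,y)>0$ for all $y\ne x$ with $p(x,y)>0$. Then $\beta_1(M_2(G))=0$.
   Context: A Markov chain $(V,p)$: $p:V\times V\to[0,1]$ with $\sum_y p(x,y)=1$; irreducible (any two states joined by a path of positive-probability transitions); symmetric support: $p(x,y)>0$ iff $p(y,x)>0$. The induced graph $G$ has $x\sim y$ iff $x\neq y$ and $p(x,y)>0$. A general path distance is symmetric $d:V\times V\to[0,\infty)$ with $d(x,y)=0$ iff $x=y$ and $d(x,y)=\inf\{\sum_k d(x_{k-1},x_k):x=x_0\sim\dots\sim x_n=y\}$. Laplacian $\Delta f(x)=\sum_y p(x,y)(f(y)-f(x))$; $\nabla_{xy}f=(f(x)-f(y))/d(x,y)$; $\|\nabla f\|_\infty=\sup_{x\ne y}|\nabla_{xy}f|$; Ollivier curvature $\kappa(x,y)=\inf\{\nabla_{xy}\Delta f:\nabla_{yx}f=1,\|\nabla f\|_\infty=1\}$; non-negative Ollivier curvature means $\kappa(x,y)\ge0$ for all $x\sim y$. $M_2(G)$: 1-forms are antisymmetric functions $\alpha(x,y)=-\alpha(y,x)$ on ordered adjacent pairs; a cycle is $(x_0\sim\dots\sim x_{n-1})$ of distinct vertices, $n\ge3$, $x_{n-1}\sim x_0$, up to rotation and reversal; $X_2$ = cycles admitting a labeling with $n=3$, or with $d(x_0,x_3)<d(x_0,x_1)+d(x_1,x_2)+d(x_2,x_3)$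 and $x_3\sim\dots\sim x_{n-1}\sim x_0$ a geodesic. $\delta\alpha(c)=\sum_i\alpha(x_i,x_{i+1\bmod n})$ for $c\in X_2$; $\delta_0 f(x,y)=f(x)-f(y)$. $\beta_1(M_2(G))=\dim(\ker\delta_1/\operatorname{Im}\delta_0)$, where $\ker\delta_1$ is the space of 1-forms with $\delta\alpha=0$ on $X_2$; equivalently $\beta_1=\dim\{\alpha:\delta\alpha=0\text{ on }X_2,\ \sum_y p(x,y)\alpha(x,y)\text{ is constant in }x\}$. *)

theory Defs
  imports "HOL-Analysis.Analysis"
begin

section \<open>Markov chains, induced graph and path distances\<close>

definition markov_chain :: "('v::finite \<Rightarrow> 'v \<Rightarrow> real) \<Rightarrow> bool" where
  "markov_chain p \<longleftrightarrow> (\<forall>x y. 0 \<le> p x y \<and> p x y \<le> 1) \<and> (\<forall>x. (\<Sum>y\<in>UNIV. p x y) = 1)"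

definition irreducible_chain :: "('v \<Rightarrow> 'v \<Rightarrow> real) \<Rightarrow> bool" where
  "irreducible_chain p \<longleftrightarrow> (\<forall>x y. (\<lambda>u v. p u v > 0)\<^sup>*\<^sup>* x y)"

definition symmetric_support :: "('v \<Rightarrow> 'v \<Rightarrow> real) \<Rightarrow> bool" where
  "symmetric_support p \<longleftrightarrow> (\<forall>x y. p x y > 0 \<longleftrightarrow> p y x > 0)"

definition adj :: "('v \<Rightarrow> 'v \<Rightarrow> real) \<Rightarrow> 'v \<Rightarrow> 'v \<Rightarrow> bool" where
  "adj p x y \<longleftrightarrow> x \<noteq> y \<and> p x y > 0"

text \<open>A path \<open>x\<^sub>0 \<sim> \<dots> \<sim> x\<^sub>n\<close> is the nonempty list of its vertices; vertices may repeat,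
  and the one-vertex list is the path with \<open>n = 0\<close>.\<close>

definition graph_path :: "('v \<Rightarrow> 'v \<Rightarrow> real) \<Rightarrow> 'v list \<Rightarrow> bool" where
  "graph_path p xs \<longleftrightarrow> xs \<noteq> [] \<and> successively (adj p) xs"

definition path_length :: "('v \<Rightarrow> 'v \<Rightarrow> real) \<Rightarrow> 'v list \<Rightarrow> real" where
  "path_length d xs = (\<Sum>k=1..<length xs. d (xs ! (k - 1)) (xs ! k))"

definition general_path_distance ::
  "('v \<Rightarrow> 'v \<Rightarrow> real) \<Rightarrow> ('v \<Rightarrow> 'v \<Rightarrow> real) \<Rightarrow> bool" where
  "general_path_distance p d \<longleftrightarrow>
     (\<forall>x y. d x y = d y x) \<and>
     (\<forall>x y. 0 \<le> d x y) \<and>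
     (\<forall>x y. d x y = 0 \<longleftrightarrow> x = y) \<and>
     (\<forall>x y. d x y = Inf {path_length d xs | xs. graph_path p xs \<and> hd xs = x \<and> last xs = y})"

definition geodesic :: "('v \<Rightarrow> 'v \<Rightarrow> real) \<Rightarrow> ('v \<Rightarrow> 'v \<Rightarrow> real) \<Rightarrow> 'v list \<Rightarrow> bool" where
  "geodesic p d xs \<longleftrightarrow> graph_path p xs \<and> path_length d xs = d (hd xs) (last xs)"


section \<open>Ollivier curvature\<close>

definition laplacian :: "('v::finite \<Rightarrow> 'v \<Rightarrow> real) \<Rightarrow> ('v \<Rightarrow> real) \<Rightarrow> 'v \<Rightarrow> real" where
  "laplacian p f x = (\<Sum>y\<in>UNIV. p x y * (f y - f x))"

definition gradient :: "('v \<Rightarrow> 'v \<Rightarrow> real) \<Rightarrow> ('v \<Rightarrow> real) \<Rightarrow> 'v \<Rightarrow> 'v \<Rightarrow> real" where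
  "gradient d f x y = (f x - f y) / d x y"

definition gradient_norm :: "('v \<Rightarrow> 'v \<Rightarrow> real) \<Rightarrow> ('v \<Rightarrow> real) \<Rightarrow> real" where
  "gradient_norm d f = Sup {\<bar>gradient d f x y\<bar> | x y. x \<noteq> y}"

definition ollivier_curvature ::
  "('v::finite \<Rightarrow> 'v \<Rightarrow> real) \<Rightarrow> ('v \<Rightarrow> 'v \<Rightarrow> real) \<Rightarrow> 'v \<Rightarrow> 'v \<Rightarrow> real" where
  "ollivier_curvature p d x y =
     Inf {gradient d (laplacian p f) x y | f. gradient d f y x = 1 \<and> gradient_norm d f = 1}"

definition nonneg_ollivier_curvature ::
  "('v::finite \<Rightarrow> 'v \<Rightarrow> real) \<Rightarrow> ('v \<Rightarrow> 'v \<Rightarrow> real) \<Rightarrow> bool" where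
  "nonneg_ollivier_curvature p d \<longleftrightarrow> (\<forall>x y. adj p x y \<longrightarrow> 0 \<le> ollivier_curvature p d x y)"


section \<open>Cycles and the cell complex\<close>

text \<open>A cycle is given by a labelling, i.e. the list \<open>[x\<^sub>0, \<dots>, x\<^bsub>n-1\<^esub>]\<close>; two labellings
  describe the same cycle iff they agree up to rotation and reversal.\<close>

definition is_cycle :: "('v \<Rightarrow> 'v \<Rightarrow> real) \<Rightarrow> 'v list \<Rightarrow> bool" where
  "is_cycle p c \<longleftrightarrow>
     3 \<le> length c \<and> distinct c \<and> successively (adj p) c \<and> adj p (last c) (hd c)"

definition same_cycle :: "'v list \<Rightarrow> 'v list \<Rightarrow> bool" where
  "same_cycle c c' \<longleftrightarrow> (\<exists>k. c' = rotate k c \<or> c' = rotate k (rev c))"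

text \<open>The set \<open>X\<^sub>2\<close> of 2-cells contains every labelling of each of its cycles. The list
  \<open>drop 3 c @ [hd c]\<close> is the path \<open>x\<^sub>3 \<sim> \<dots> \<sim> x\<^bsub>n-1\<^esub> \<sim> x\<^sub>0\<close>.\<close>

definition cells2 :: "('v \<Rightarrow> 'v \<Rightarrow> real) \<Rightarrow> ('v \<Rightarrow> 'v \<Rightarrow> real) \<Rightarrow> 'v list set" where
  "cells2 p d =
     {c. is_cycle p c \<and>
         (\<exists>c'. same_cycle c c' \<and>
            (length c' = 3 \<or>
             4 \<le> length c' \<and>
             d (c' ! 0) (c' ! 3) < d (c' ! 0) (c' ! 1) + d (c' ! 1) (c' ! 2) + d (c' ! 2) (c' ! 3) \<and>
             geodesic p d (drop 3 c' @ [hd c'])))}"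


section \<open>Forms, coboundaries and the first Betti number\<close>

text \<open>A function on ordered adjacent pairs is encoded as a vector indexed by all pairs that
  vanishes on the non-adjacent ones.\<close>

definition one_forms :: "('v::finite \<Rightarrow> 'v \<Rightarrow> real) \<Rightarrow> (real ^ ('v \<times> 'v)) set" where
  "one_forms p =
     {\<alpha>. (\<forall>x y. adj p x y \<longrightarrow> \<alpha> $ (x, y) = - \<alpha> $ (y, x)) \<and>
         (\<forall>x y. \<not> adj p x y \<longrightarrow> \<alpha> $ (x, y) = 0)}"

definition coboundary0 ::
  "('v::finite \<Rightarrow> 'v \<Rightarrow> real) \<Rightarrow> ('v \<Rightarrow> real) \<Rightarrow> real ^ ('v \<times> 'v)" where
  "coboundary0 p f = (\<chi> e. if adj p (fst e) (snd e) then f (fst e) - f (snd e) else 0)"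

definition coboundary1 :: "real ^ ('v \<times> 'v) \<Rightarrow> ('v::finite) list \<Rightarrow> real" where
  "coboundary1 \<alpha> c = (\<Sum>i<length c. \<alpha> $ (c ! i, c ! ((i + 1) mod length c)))"

definition ker_coboundary1 ::
  "('v::finite \<Rightarrow> 'v \<Rightarrow> real) \<Rightarrow> ('v \<Rightarrow> 'v \<Rightarrow> real) \<Rightarrow> (real ^ ('v \<times> 'v)) set" where
  "ker_coboundary1 p d = {\<alpha> \<in> one_forms p. \<forall>c\<in>cells2 p d. coboundary1 \<alpha> c = 0}"

definition im_coboundary0 :: "('v::finite \<Rightarrow> 'v \<Rightarrow> real) \<Rightarrow> (real ^ ('v \<times> 'v)) set" where
  "im_coboundary0 p = range (coboundary0 p)"

text \<open>For subspaces \<open>I \<subseteq> K\<close>: \<open>B\<close> represents a basis of the quotient space \<open>K / I\<close>, i.e. the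
  cosets \<open>b + I\<close>, \<open>b \<in> B\<close>, are pairwise distinct and form a basis of it.\<close>

definition quotient_basis :: "'a::euclidean_space set \<Rightarrow> 'a set \<Rightarrow> 'a set \<Rightarrow> bool" where
  "quotient_basis K I B \<longleftrightarrow>
     finite B \<and> B \<subseteq> K \<and>
     (\<forall>c. (\<Sum>b\<in>B. c b *\<^sub>R b) \<in> I \<longrightarrow> (\<forall>b\<in>B. c b = 0)) \<and>
     (\<forall>v\<in>K. \<exists>c. v - (\<Sum>b\<in>B. c b *\<^sub>R b) \<in> I)"

definition quotient_dim :: "'a::euclidean_space set \<Rightarrow> 'a set \<Rightarrow> nat" where
  "quotient_dim K I = card (SOME B. quotient_basis K I B)"

lemma quotient_basis_card:
  assumes K: "subspace K" and I: "subspace I" and "I \<subseteq> K" and B: "quotient_basis K I B"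
  shows "card B + dim I = dim K"
proof -
  obtain C where C: "C \<subseteq> I" "independent C" "I \<subseteq> span C" "card C = dim I"
    using basis_exists[of I] by blast
  have finB: "finite B" and BK: "B \<subseteq> K" using B by (auto simp: quotient_basis_def)
  have ind: "\<And>c b. (\<Sum>b\<in>B. c b *\<^sub>R b) \<in> I \<Longrightarrow> b \<in> B \<Longrightarrow> c b = 0"
    using B by (auto simp: quotient_basis_def)
  have finC: "finite C" using C(2) by (rule independent_imp_finite)
  have spC: "span C = I" using C(3) span_minimal[OF C(1) I] by (intro equalityI)
  have disj: "B \<inter> C = {}"
  proof (rule ccontr)
    assume "B \<inter> C \<noteq> {}"
    then obtain b where b: "b \<in> B" "b \<in> C" by auto
    have "(\<Sum>a\<in>B. (if a = b then 1 else 0) *\<^sub>R a) = (\<Sum>a\<in>B. if a = b then a else 0)"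
      by (rule sum.cong) auto
    also have "\<dots> = b" using b finB by simp
    finally show False using ind[of "\<lambda>a. if a = b then 1 else 0" b] b C(1) by auto
  qed
  have "independent (B \<union> C)"
  proof (rule independent_if_scalars_zero)
    fix f x assume s: "(\<Sum>x\<in>B \<union> C. f x *\<^sub>R x) = 0" and x: "x \<in> B \<union> C"
    have eq: "(\<Sum>x\<in>B. f x *\<^sub>R x) + (\<Sum>x\<in>C. f x *\<^sub>R x) = 0"
      using s disj finB finC by (simp add: sum.union_disjoint)
    have "(\<Sum>x\<in>C. f x *\<^sub>R x) \<in> I" using C(1) by (auto intro!: subspace_sum[OF I] subspace_scale[OF I])
    then have "(\<Sum>x\<in>B. f x *\<^sub>R x) \<in> I"
      using subspace_neg[OF I] eq by (simp add: add_eq_0_iff2)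
    then have B0: "\<forall>b\<in>B. f b = 0" using ind by blast
    then have "(\<Sum>x\<in>C. f x *\<^sub>R x) = 0" using eq by simp
    then have "\<forall>b\<in>C. f b = 0" using independentD[OF C(2) finC subset_refl] by blast
    then show "f x = 0" using B0 x by auto
  qed (use finB finC in auto)
  moreover have "B \<union> C \<subseteq> K" using BK C(1) \<open>I \<subseteq> K\<close> by auto
  moreover have "K \<subseteq> span (B \<union> C)"
  proof
    fix v assume "v \<in> K"
    then obtain c where c: "v - (\<Sum>b\<in>B. c b *\<^sub>R b) \<in> I"
      using B by (auto simp: quotient_basis_def)
    then have "v - (\<Sum>b\<in>B. c b *\<^sub>R b) \<in> span (B \<union> C)"
      using spC span_mono[of C "B \<union> C"] by auto
    moreover have "(\<Sum>b\<in>B. c b *\<^sub>R b) \<in> span (B \<union> C)"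
      by (intro span_sum span_scale span_base) auto
    ultimately have "(v - (\<Sum>b\<in>B. c b *\<^sub>R b)) + (\<Sum>b\<in>B. c b *\<^sub>R b) \<in> span (B \<union> C)"
      by (rule span_add)
    then show "v \<in> span (B \<union> C)" by simp
  qed
  ultimately have "card (B \<union> C) = dim K" by (intro basis_card_eq_dim)
  then show ?thesis using C(4) disj finB finC by (simp add: card_Un_disjoint)
qed

lemma quotient_basis_exists:
  assumes K: "subspace K" and I: "subspace I" and "I \<subseteq> K"
  shows "\<exists>B. quotient_basis K I B"
proof -
  obtain C where C: "C \<subseteq> I" "independent C" "I \<subseteq> span C" "card C = dim I"
    using basis_exists[of I] by blast
  have "C \<subseteq> K" using C(1) \<open>I \<subseteq> K\<close> by auto
  from maximal_independent_subset_extend[OF this C(2)]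
  obtain D where D: "C \<subseteq> D" "D \<subseteq> K" "independent D" "K \<subseteq> span D" .
  have finD: "finite D" using D(3) by (rule independent_imp_finite)
  have finC: "finite C" using finD D(1) finite_subset by blast
  have spC: "span C = I" using C(3) span_minimal[OF C(1) I] by (intro equalityI)
  have split: "(\<Sum>b\<in>D. g b *\<^sub>R b) = (\<Sum>b\<in>D - C. g b *\<^sub>R b) + (\<Sum>b\<in>C. g b *\<^sub>R b)" for g
    using sum.subset_diff[OF D(1) finD] .
  have "quotient_basis K I (D - C)"
    unfolding quotient_basis_def
  proof (intro conjI allI impI ballI)
    show "finite (D - C)" "D - C \<subseteq> K" using finD D(2) by auto
  next
    fix c b assume c: "(\<Sum>b\<in>D - C. c b *\<^sub>R b) \<in> I" and b: "b \<in> D - C"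
    then obtain u where u: "(\<Sum>b\<in>D - C. c b *\<^sub>R b) = (\<Sum>b\<in>C. u b *\<^sub>R b)"
      using spC span_finite[OF finC] by auto
    define g where "g = (\<lambda>b. if b \<in> C then - u b else c b)"
    have "(\<Sum>b\<in>D. g b *\<^sub>R b) = (\<Sum>b\<in>D - C. c b *\<^sub>R b) + (\<Sum>b\<in>C. - (u b *\<^sub>R b))"
      unfolding split by (intro arg_cong2[where f = "(+)"] sum.cong) (auto simp: g_def)
    also have "\<dots> = 0" using u by (simp add: sum_negf)
    finally have "g b = 0" using independentD[OF D(3) finD subset_refl] b by blast
    then show "c b = 0" using b by (simp add: g_def)
  next
    fix v assume "v \<in> K"
    then obtain g where "v = (\<Sum>b\<in>D. g b *\<^sub>R b)"
      using D(4) span_finite[OF finD] by auto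
    then have "v - (\<Sum>b\<in>D - C. g b *\<^sub>R b) = (\<Sum>b\<in>C. g b *\<^sub>R b)" using split[of g] by simp
    moreover have "(\<Sum>b\<in>C. g b *\<^sub>R b) \<in> I" using C(1) by (auto intro!: subspace_sum[OF I] subspace_scale[OF I])
    ultimately show "\<exists>c. v - (\<Sum>b\<in>D - C. c b *\<^sub>R b) \<in> I" by metis
  qed
  then show ?thesis ..
qed

lemma quotient_dim_eq:
  assumes "subspace K" "subspace I" "I \<subseteq> K"
  shows "quotient_dim K I + dim I = dim K"
  unfolding quotient_dim_def
  by (rule quotient_basis_card[OF assms someI_ex[OF quotient_basis_exists[OF assms]]])

lemma subspace_ker_coboundary1: "subspace (ker_coboundary1 p d)"
proof -
  have "coboundary1 0 c = 0" "coboundary1 (\<alpha> + \<beta>) c = coboundary1 \<alpha> c + coboundary1 \<beta> c"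
    "coboundary1 (r *\<^sub>R \<alpha>) c = r * coboundary1 \<alpha> c" for \<alpha> \<beta> :: "real ^ ('a \<times> 'a)" and r c
    by (simp_all add: coboundary1_def sum.distrib sum_distrib_left)
  then show ?thesis
    by (simp add: subspace_def ker_coboundary1_def one_forms_def)
qed

lemma subspace_im_coboundary0: "subspace (im_coboundary0 p)"
  unfolding subspace_def im_coboundary0_def
proof (intro conjI ballI allI)
  have "0 = coboundary0 p (\<lambda>_. 0)" by (simp add: coboundary0_def vec_eq_iff)
  then show "0 \<in> range (coboundary0 p)" by (metis rangeI)
next
  fix a b assume "a \<in> range (coboundary0 p)" "b \<in> range (coboundary0 p)"
  then obtain f g where "a = coboundary0 p f" "b = coboundary0 p g" by auto
  then have "a + b = coboundary0 p (\<lambda>x. f x + g x)" by (simp add: coboundary0_def vec_eq_iff)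
  then show "a + b \<in> range (coboundary0 p)" by (metis rangeI)
next
  fix c a assume "a \<in> range (coboundary0 p)"
  then obtain f where "a = coboundary0 p f" by auto
  then have "c *\<^sub>R a = coboundary0 p (\<lambda>x. c * f x)"
    by (simp add: coboundary0_def vec_eq_iff algebra_simps)
  then show "c *\<^sub>R a \<in> range (coboundary0 p)" by (metis rangeI)
qed

lemma im_coboundary0_subset_ker_coboundary1:
  assumes "symmetric_support p"
  shows "im_coboundary0 p \<subseteq> ker_coboundary1 p d"
proof
  fix \<alpha> assume "\<alpha> \<in> im_coboundary0 p"
  then obtain f where \<alpha>: "\<alpha> = coboundary0 p f" by (auto simp: im_coboundary0_def)
  have "\<alpha> \<in> one_forms p"
    using assms by (auto simp: \<alpha> one_forms_def coboundary0_def adj_def symmetric_support_def)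
  moreover have "coboundary1 \<alpha> c = 0" if "c \<in> cells2 p d" for c
  proof -
    have c: "is_cycle p c" using that by (simp add: cells2_def)
    then obtain m where m: "length c = Suc m" by (cases c) (auto simp: is_cycle_def)
    have step: "adj p (c ! i) (c ! Suc i)" if "i < m" for i
      using c m that by (auto simp: is_cycle_def successively_conv_nth)
    have close: "adj p (c ! m) (c ! 0)"
      using c m by (cases "c = []") (auto simp: is_cycle_def last_conv_nth hd_conv_nth)
    have "coboundary1 \<alpha> c = (\<Sum>i<m. f (c ! i) - f (c ! Suc i)) + (f (c ! m) - f (c ! 0))"
      using step close by (auto simp: coboundary1_def m \<alpha> coboundary0_def intro!: sum.cong)
    also have "\<dots> = 0" using sum_lessThan_telescope'[of "\<lambda>i. f (c ! i)" m] by simp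
    finally show ?thesis .
  qed
  ultimately show "\<alpha> \<in> ker_coboundary1 p d" by (simp add: ker_coboundary1_def)
qed

definition betti1 :: "('v::finite \<Rightarrow> 'v \<Rightarrow> real) \<Rightarrow> ('v \<Rightarrow> 'v \<Rightarrow> real) \<Rightarrow> nat" where
  "betti1 p d = quotient_dim (ker_coboundary1 p d) (im_coboundary0 p)"

end

theory Submission imports Defs begin

text \<open>
  Every class in \<open>ker \<delta>\<^sub>1 / im \<delta>\<^sub>0\<close> has a representative \<open>\<alpha>\<close> of constant divergence; suppose
  \<open>\<alpha> \<noteq> 0\<close> and scale it so that \<open>max \<bar>\<alpha>(x,y)\<bar> / d(x,y) = 1\<close>. Around an edge \<open>x \<sim> y\<close> with
  \<open>\<alpha>(x,y) = d(x,y)\<close> (a maximal edge), the 2-cells make \<open>\<alpha>\<close> the differential of a 1-Lipschitz function, and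
  testing the curvature on it gives \<open>\<kappa>(x,y) d(x,y) \<le> div \<alpha>(x) - div \<alpha>(y)\<close>. So maximal edges have
  \<open>\<kappa> = 0\<close>, and it remains to find one leaving the vertex of positive curvature.

  Applying the same inequality to \<open>\<alpha> - \<epsilon> \<delta>\<^sub>0 g\<close> shows \<open>\<Delta>g(x) \<ge> \<Delta>g(y)\<close> on a maximal edge \<open>(x,y)\<close>,
  provided \<open>(g(u) - g(v)) / d(u,v)\<close> is minimal there among all maximal edges. If the directed graph
  of maximal edges were acyclic, the maximal length of a directed path from \<open>v\<close> would be such a
  \<open>g\<close>, contradicting the maximum principle. With \<open>g = - 1\<^sub>T\<close> for forward closed sets \<open>T\<close>, the
  transition mass into \<open>T\<close> grows along maximal edges. Hence, if some neighbour of a vertex leading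
  to a cycle did not itself lead to a cycle, then one such vertex \<open>t\<close> would be adjacent to a whole
  cycle of maximal edges. The triangles with apex \<open>t\<close> would then force the integral of \<open>\<alpha>\<close> over
  that cycle to vanish. So every vertex leads to a cycle, and in particular starts a maximal edge.
\<close>

section \<open>Path sums along lists and longest directed paths\<close>

lemma path_length_singleton [simp]: "path_length w [x] = 0"
  by (simp add: path_length_def)

lemma path_length_Cons_Cons [simp]:
  "path_length w (x # y # zs) = w x y + path_length w (y # zs)"
proof -
  have "path_length w (x # y # zs)
      = (\<Sum>k=1..<Suc (Suc (length zs)). w ((x # y # zs) ! (k - 1)) ((x # y # zs) ! k))"
    by (simp add: path_length_def)
  also have "\<dots> = w x y
      + (\<Sum>k=Suc 1..<Suc (Suc (length zs)). w ((x # y # zs) ! (k - 1)) ((x # y # zs) ! k))"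
    by (subst sum.atLeast_Suc_lessThan) auto
  also have "(\<Sum>k=Suc 1..<Suc (Suc (length zs)). w ((x # y # zs) ! (k - 1)) ((x # y # zs) ! k))
      = (\<Sum>k=1..<Suc (length zs). w ((x # y # zs) ! (Suc k - 1)) ((x # y # zs) ! Suc k))"
    by (rule sum.shift_bounds_Suc_ivl)
  also have "\<dots> = path_length w (y # zs)"
    unfolding path_length_def by (intro sum.cong) (auto simp: nth_Cons')
  finally show ?thesis .
qed

lemma path_length_append:
  "path_length w (xs @ y # zs) = path_length w (xs @ [y]) + path_length w (y # zs)"
proof (induction xs)
  case (Cons a xs)
  then show ?case by (cases xs) auto
qed simp

text \<open>Repeating the first vertex at the end replaces the indices modulo the length by a path
  sum, so that the list recursion of \<open>path_length\<close> applies. The weight here is the form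
  itself, which may be negative.\<close>

lemma coboundary1_eq_path_length:
  assumes "c \<noteq> []"
  shows "coboundary1 \<alpha> c = path_length (\<lambda>x y. \<alpha> $ (x, y)) (c @ [hd c])"
proof -
  have "path_length (\<lambda>x y. \<alpha> $ (x, y)) (c @ [hd c])
      = (\<Sum>k=1..<Suc (length c). \<alpha> $ ((c @ [hd c]) ! (k - 1), (c @ [hd c]) ! k))"
    by (simp add: path_length_def)
  also have "\<dots> = (\<Sum>k<length c. \<alpha> $ ((c @ [hd c]) ! (Suc k - 1), (c @ [hd c]) ! Suc k))"
    by (simp only: One_nat_def sum.shift_bounds_Suc_ivl atLeast0LessThan)
  also have "\<dots> = coboundary1 \<alpha> c"
    unfolding coboundary1_def
  proof (intro sum.cong refl)
    fix k assume "k \<in> {..<length c}"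
    then have k: "k < length c" by simp
    show "\<alpha> $ ((c @ [hd c]) ! (Suc k - 1), (c @ [hd c]) ! Suc k)
        = \<alpha> $ (c ! k, c ! ((k + 1) mod length c))"
    proof (cases "Suc k = length c")
      case True
      then have "length c = Suc k" by simp
      then show ?thesis using assms by (simp add: nth_append hd_conv_nth)
    next
      case False
      then show ?thesis using k by (simp add: nth_append)
    qed
  qed
  finally show ?thesis ..
qed

text \<open>\<open>D v\<close> is the largest \<open>d\<close>-length of an \<open>R\<close>-path
  starting at \<open>v\<close>; the empty path contributes the 0. The recursion is well founded
  because \<open>A f v\<close> depends on \<open>f\<close> only at the \<open>R\<close>-successors
  of \<open>v\<close>.\<close>

lemma wf_longest_path:
  fixes R :: "('a::finite \<times> 'a) set" and d :: "'a \<Rightarrow> 'a \<Rightarrow> real"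
  assumes "wf (R\<inverse>)"
  obtains D where "\<And>v. 0 \<le> D v"
    and "\<And>v w. (v, w) \<in> R \<Longrightarrow> d v w \<le> D v - D w"
    and "\<And>v. D v \<noteq> 0 \<Longrightarrow> \<exists>w. (v, w) \<in> R \<and> D v - D w = d v w"
proof -
  define A where "A f v = insert 0 ((\<lambda>w. d v w + f w) ` {w. (v, w) \<in> R})" for f :: "'a \<Rightarrow> real" and v
  have "\<exists>D. \<forall>v. D v = Max (A D v)"
  proof (rule dependent_wf_choice[OF assms, where P = "\<lambda>f v r. r = Max (A f v)"])
    fix f g :: "'a \<Rightarrow> real" and v r
    assume "\<And>z. (z, v) \<in> R\<inverse> \<Longrightarrow> f z = g z"
    then have "A f v = A g v" by (auto simp: A_def)
    then show "(r = Max (A f v)) = (r = Max (A g v))" by simp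
  qed simp
  then obtain D where D: "\<And>v. D v = Max (A D v)" by blast
  have fin: "finite (A D v)" for v by (simp add: A_def)
  show thesis
  proof (rule that[of D])
    show "0 \<le> D v" for v
      using Max_ge[OF fin[of v], of 0] by (subst D) (simp add: A_def)
    show "d v w \<le> D v - D w" if "(v, w) \<in> R" for v w
    proof -
      have "d v w + D w \<in> A D v" using that by (auto simp: A_def)
      then show ?thesis using Max_ge[OF fin[of v]] D[of v] by fastforce
    qed
    show "\<exists>w. (v, w) \<in> R \<and> D v - D w = d v w" if "D v \<noteq> 0" for v
    proof -
      have "D v \<in> A D v" using Max_in[OF fin[of v]] D[of v] by (auto simp: A_def)
      then show ?thesis using that by (auto simp: A_def)
    qed
  qed
qed

section \<open>The path metric and its geodesics\<close>

locale path_metric_chain =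
  fixes p d :: "'v::finite \<Rightarrow> 'v \<Rightarrow> real"
  assumes markov: "markov_chain p"
    and irreducible: "irreducible_chain p"
    and symmetric: "symmetric_support p"
    and path_distance: "general_path_distance p d"
begin

lemma p_nonneg: "0 \<le> p x y"
  using markov by (simp add: markov_chain_def)

lemma adj_sym: "adj p x y \<Longrightarrow> adj p y x"
  using symmetric by (auto simp: adj_def symmetric_support_def)

lemma d_sym: "d x y = d y x"
  by (rule path_distance[unfolded general_path_distance_def, THEN conjunct1, THEN spec, THEN spec])

lemma d_nonneg: "0 \<le> d x y"
  by (rule path_distance[unfolded general_path_distance_def, THEN conjunct2, THEN conjunct1, THEN spec, THEN spec])

lemma d_eq_0_iff [simp]: "d x y = 0 \<longleftrightarrow> x = y"
  by (rule path_distance[unfolded general_path_distance_def, THEN conjunct2, THEN conjunct2, THEN conjunct1, THEN spec, THEN spec])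

lemma d_self [simp]: "d x x = 0"
  by simp

lemma d_pos: "x \<noteq> y \<Longrightarrow> 0 < d x y"
  using d_nonneg[of x y] d_eq_0_iff[of x y] by linarith

lemma adj_d_pos: "adj p x y \<Longrightarrow> 0 < d x y"
  by (auto simp: adj_def intro: d_pos)

lemma d_eq_Inf: "d x y = Inf {path_length d xs |xs. graph_path p xs \<and> hd xs = x \<and> last xs = y}"
  by (rule path_distance[unfolded general_path_distance_def, THEN conjunct2, THEN conjunct2, THEN conjunct2, THEN spec, THEN spec])

lemma path_length_nonneg: "0 \<le> path_length d xs"
  by (simp add: path_length_def sum_nonneg d_nonneg)

lemma d_le_path_length: "graph_path p xs \<Longrightarrow> d (hd xs) (last xs) \<le> path_length d xs"
  unfolding d_eq_Inf[of "hd xs"]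
  by (intro cInf_lower) (auto intro: bdd_belowI[of _ 0] path_length_nonneg)

lemma ex_graph_path: "\<exists>xs. graph_path p xs \<and> hd xs = x \<and> last xs = y"
proof -
  have "(\<lambda>u v. p u v > 0)\<^sup>*\<^sup>* x y" using irreducible by (simp add: irreducible_chain_def)
  then show ?thesis
  proof (induction rule: converse_rtranclp_induct)
    case base
    have "graph_path p [y]" by (simp add: graph_path_def)
    then show ?case by (intro exI[of _ "[y]"]) simp
  next
    case (step u v)
    then obtain xs where xs: "graph_path p xs" "hd xs = v" "last xs = y" by blast
    show ?case
    proof (cases "u = v")
      case True
      then show ?thesis using xs by blast
    next
      case False
      then have "graph_path p (u # xs)" using xs step(1)
        by (auto simp: graph_path_def adj_def successively_Cons)
      then show ?thesis using xs by (intro exI[of _ "u # xs"]) (auto simp: graph_path_def)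
    qed
  qed
qed

text \<open>Every edge has length at least some \<open>\<mu> > 0\<close>, so a bound on the length
  of a path bounds its number of vertices. Only finitely many paths compete, and the infimum is a
  minimum.\<close>

lemma ex_path_attaining:
  "\<exists>xs. graph_path p xs \<and> hd xs = x \<and> last xs = y \<and> path_length d xs = d x y"
proof -
  define P where "P = {xs. graph_path p xs \<and> hd xs = x \<and> last xs = y}"
  define E where "E = {e :: 'v \<times> 'v. fst e \<noteq> snd e}"
  \<comment> \<open>The inserted 1 keeps the set nonempty when there is only one vertex.\<close>
  define \<mu> where "\<mu> = Min (insert 1 ((\<lambda>e. d (fst e) (snd e)) ` E))"
  have \<mu>: "0 < \<mu>" by (auto simp: \<mu>_def E_def intro: d_pos)
  have \<mu>_le: "\<mu> \<le> d u v" if "u \<noteq> v" for u v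
  proof -
    have "d u v \<in> (\<lambda>e. d (fst e) (snd e)) ` E" using that by (intro image_eqI[of _ _ "(u, v)"]) (auto simp: E_def)
    then show ?thesis unfolding \<mu>_def by (intro Min_le) auto
  qed
  have long: "\<mu> * (real (length xs) - 1) \<le> path_length d xs" if "successively (adj p) xs" "xs \<noteq> []" for xs
    using that
  proof (induction xs rule: induct_list012)
    case (3 a b zs)
    then have "\<mu> \<le> d a b" by (auto simp: adj_def intro: \<mu>_le)
    then show ?case using 3 by (simp add: algebra_simps)
  qed auto
  obtain xs0 where xs0: "xs0 \<in> P" using ex_graph_path by (auto simp: P_def)
  define L where "L = path_length d xs0"
  define N where "N = nat \<lceil>L / \<mu> + 1\<rceil>"
  define Q where "Q = {xs \<in> P. path_length d xs \<le> L}"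
  have "Q \<subseteq> {xs. set xs \<subseteq> UNIV \<and> length xs \<le> N}"
  proof
    fix xs assume xs: "xs \<in> Q"
    then have "\<mu> * (real (length xs) - 1) \<le> L"
      using long[of xs] by (auto simp: Q_def P_def graph_path_def)
    then have "real (length xs) \<le> L / \<mu> + 1" using \<mu> by (simp add: field_simps)
    then show "xs \<in> {xs. set xs \<subseteq> UNIV \<and> length xs \<le> N}" unfolding N_def
      by (simp add: le_nat_iff le_ceiling_iff) linarith
  qed
  then have fin: "finite Q" by (rule finite_subset) (rule finite_lists_length_le, rule finite)
  have "xs0 \<in> Q" using xs0 by (simp add: Q_def L_def)
  then have ne: "path_length d ` Q \<noteq> {}" by blast
  then have "Min (path_length d ` Q) \<in> path_length d ` Q" using fin by (intro Min_in) auto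
  then obtain ys where ys: "ys \<in> Q" "path_length d ys = Min (path_length d ` Q)" by auto
  have least: "path_length d ys \<le> path_length d xs" if "xs \<in> P" for xs
  proof (cases "path_length d xs \<le> L")
    case True
    then show ?thesis using ys(2) that fin by (simp add: Q_def)
  next
    case False
    then show ?thesis using ys(1) by (simp add: Q_def)
  qed
  have "d x y = path_length d ys"
    unfolding d_eq_Inf[of x y]
    by (rule cInf_eq_minimum) (use ys(1) least in \<open>auto simp: Q_def P_def\<close>)
  then show ?thesis using ys(1) by (auto simp: Q_def P_def)
qed

lemma d_triangle: "d x z \<le> d x y + d y z"
proof -
  obtain xs ys where xs: "graph_path p xs" "hd xs = x" "last xs = y" "path_length d xs = d x y"
    and ys: "graph_path p ys" "hd ys = y" "last ys = z" "path_length d ys = d y z"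
    using ex_path_attaining by metis
  obtain xs' where xs': "xs = xs' @ [y]" using xs(1,3) by (metis append_butlast_last_id graph_path_def)
  obtain ys' where ys': "ys = y # ys'" using ys(1,2) by (metis graph_path_def list.collapse)
  have "graph_path p (xs' @ ys)" using xs(1) ys(1)
    unfolding xs' ys' graph_path_def by (auto simp: successively_append_iff)
  moreover have "hd (xs' @ ys) = x" using xs(2) ys(2) by (cases xs') (auto simp: xs')
  moreover have "last (xs' @ ys) = z" using ys by (auto simp: graph_path_def)
  ultimately have "d x z \<le> path_length d (xs' @ ys)" using d_le_path_length by metis
  then show ?thesis using xs(4) ys(4) path_length_append[of d xs' y ys'] by (simp add: xs' ys')
qed

lemma geodesic_split:
  assumes "geodesic p d (xs @ y # zs)"
  shows "geodesic p d (xs @ [y])" and "geodesic p d (y # zs)"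
    and "d (hd (xs @ [y])) (last (y # zs)) = d (hd (xs @ [y])) y + d y (last (y # zs))"
proof -
  have g: "graph_path p (xs @ [y])" "graph_path p (y # zs)"
    using assms unfolding geodesic_def graph_path_def
    by (auto simp: successively_append_iff)
  have hd: "hd (xs @ y # zs) = hd (xs @ [y])" by (cases xs) auto
  have len: "path_length d (xs @ [y]) + path_length d (y # zs) = d (hd (xs @ [y])) (last (y # zs))"
    using assms unfolding geodesic_def hd path_length_append[of d xs y zs] by simp
  have "d (hd (xs @ [y])) y \<le> path_length d (xs @ [y])" "d y (last (y # zs)) \<le> path_length d (y # zs)"
    using d_le_path_length[OF g(1)] d_le_path_length[OF g(2)] by simp_all
  then show "geodesic p d (xs @ [y])" "geodesic p d (y # zs)"
    "d (hd (xs @ [y])) (last (y # zs)) = d (hd (xs @ [y])) y + d y (last (y # zs))"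
    using len g d_triangle[of "hd (xs @ [y])" "last (y # zs)" y] by (auto simp: geodesic_def)
qed

text \<open>Between two visits of \<open>y\<close> a geodesic would contain a geodesic from
  \<open>y\<close> to \<open>y\<close>, of length 0 and yet with an edge of positive length.\<close>

lemma geodesic_distinct: "geodesic p d xs \<Longrightarrow> distinct xs"
proof (rule ccontr)
  assume g: "geodesic p d xs" and "\<not> distinct xs"
  then obtain as bs cs y where xs: "xs = as @ [y] @ bs @ [y] @ cs"
    using not_distinct_decomp by blast
  have "geodesic p d ((y # bs) @ y # cs)" using geodesic_split(2)[of as y "bs @ y # cs"] g xs by simp
  then have g2: "geodesic p d (y # bs @ [y])" using geodesic_split(1)[of "y # bs" y cs] by simp
  obtain b bs' where b: "bs @ [y] = b # bs'" by (cases bs) auto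
  have "adj p y b" using g2 unfolding geodesic_def graph_path_def b by simp
  then have "0 < path_length d (y # bs @ [y])"
    unfolding b using adj_d_pos[of y b] path_length_nonneg[of "b # bs'"] by simp
  then show False using g2 by (simp add: geodesic_def)
qed

lemma geodesic_through:
  assumes "geodesic p d xs" "y \<in> set xs"
  shows "d (hd xs) (last xs) = d (hd xs) y + d y (last xs)"
proof -
  obtain as bs where xs: "xs = as @ y # bs" using assms(2) by (meson split_list)
  moreover have "hd xs = hd (as @ [y])" unfolding xs by (cases as) auto
  ultimately show ?thesis using geodesic_split(3)[of as y bs] assms(1) by simp
qed

lemma ex_geodesic:
  assumes "x \<noteq> y"
  obtains zs where "geodesic p d (x # zs @ [y])"
proof -
  obtain xs where xs: "graph_path p xs" "hd xs = x" "last xs = y" "path_length d xs = d x y"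
    using ex_path_attaining by metis
  then obtain as where as: "xs = as @ [y]" by (metis append_butlast_last_id graph_path_def)
  with xs(2) assms have "as \<noteq> []" by auto
  then obtain zs where "as = x # zs" using xs(2) as by (cases as) auto
  then show thesis using that[of zs] xs as by (simp add: geodesic_def)
qed

section \<open>Closed 1-forms bounded by the distance\<close>

lemma one_forms_antisym: "\<beta> \<in> one_forms p \<Longrightarrow> \<beta> $ (y, x) = - \<beta> $ (x, y)"
  unfolding one_forms_def mem_Collect_eq using adj_sym by (metis minus_zero)

lemma one_forms_diag: "\<beta> \<in> one_forms p \<Longrightarrow> \<beta> $ (x, x) = 0"
  by (simp add: one_forms_def adj_def)

lemma path_length_ge:
  assumes \<beta>: "\<beta> \<in> one_forms p" and le: "\<And>u v. adj p u v \<Longrightarrow> \<beta> $ (u, v) \<le> d u v"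
    and "graph_path p xs"
  shows "- path_length d xs \<le> path_length (\<lambda>u v. \<beta> $ (u, v)) xs"
proof -
  have "xs \<noteq> []" "successively (adj p) xs" using assms(3) by (auto simp: graph_path_def)
  then show ?thesis
  proof (induction xs rule: induct_list012)
    case (3 a b zs)
    then have "adj p b a" using adj_sym by simp
    then have "- d a b \<le> \<beta> $ (a, b)" using le[of b a] one_forms_antisym[OF \<beta>, of b a] d_sym[of a b] by simp
    then show ?case using 3 by simp
  qed auto
qed

lemma cell_path_length:
  assumes "\<beta> \<in> ker_coboundary1 p d" "is_cycle p c"
    and "length c = 3 \<or> 4 \<le> length c \<and>
      d (c ! 0) (c ! 3) < d (c ! 0) (c ! 1) + d (c ! 1) (c ! 2) + d (c ! 2) (c ! 3) \<and>
      geodesic p d (drop 3 c @ [hd c])"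
  shows "path_length (\<lambda>u v. \<beta> $ (u, v)) (c @ [hd c]) = 0"
proof -
  have "same_cycle c c" unfolding same_cycle_def by (intro exI[of _ 0]) simp
  then have "c \<in> cells2 p d" unfolding cells2_def mem_Collect_eq
    by (intro conjI exI[of _ c] assms(2,3))
  then have "coboundary1 \<beta> c = 0" using assms(1) by (simp add: ker_coboundary1_def)
  moreover have "c \<noteq> []" using assms(2) by (auto simp: is_cycle_def)
  ultimately show ?thesis by (simp add: coboundary1_eq_path_length)
qed

lemma triangle_sum:
  assumes \<beta>: "\<beta> \<in> ker_coboundary1 p d" and "adj p a b" "adj p b c" "adj p c a"
  shows "\<beta> $ (a, b) + \<beta> $ (b, c) + \<beta> $ (c, a) = 0"
proof -
  have "is_cycle p [a, b, c]" using assms by (auto simp: is_cycle_def adj_def)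
  from cell_path_length[OF \<beta> this] show ?thesis by simp
qed

text \<open>If \<open>a\<close>, \<open>b\<close>, \<open>c\<close> is not a shortest path, a
  geodesic from \<open>c\<close> back to \<open>a\<close> closes it to a 2-cell. The sum of
  \<open>\<beta>\<close> around the cell vanishes, and along the geodesic it is at least
  \<open>- d c a\<close>.\<close>

lemma two_edge_bound:
  assumes \<beta>: "\<beta> \<in> ker_coboundary1 p d" and le: "\<And>u v. adj p u v \<Longrightarrow> \<beta> $ (u, v) \<le> d u v"
    and ab: "adj p a b" and bc: "adj p b c"
  shows "\<beta> $ (a, b) + \<beta> $ (b, c) \<le> d a c"
proof -
  have form: "\<beta> \<in> one_forms p" using \<beta> by (simp add: ker_coboundary1_def)
  consider "a = c" | "d a c = d a b + d b c" | "a \<noteq> c" "d a c < d a b + d b c"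
    using d_triangle[of a c b] by linarith
  then show ?thesis
  proof cases
    case 1
    then show ?thesis using one_forms_antisym[OF form, of a b] d_nonneg[of a c] by simp
  next
    case 2
    then show ?thesis using le[OF ab] le[OF bc] by simp
  next
    case 3
    obtain zs where g: "geodesic p d (c # zs @ [a])" using ex_geodesic 3(1) by metis
    \<comment> \<open>A geodesic through \<open>b\<close> would make \<open>d a c\<close> equal to
      the length of the two edges.\<close>
    have b: "b \<notin> set (c # zs @ [a])"
      using geodesic_through[OF g, of b] 3(2) d_sym[of c a] d_sym[of c b] d_sym[of b a] by auto
    have succ: "successively (adj p) ((c # zs) @ [a])" and gp: "graph_path p (c # zs @ [a])"
      using g by (auto simp: geodesic_def graph_path_def)
    have cyc: "is_cycle p (a # b # c # zs)"
      using geodesic_distinct[OF g] b succ ab bc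
      unfolding is_cycle_def successively_append_iff by auto
    have "path_length (\<lambda>u v. \<beta> $ (u, v)) ((a # b # c # zs) @ [hd (a # b # c # zs)]) = 0"
    proof (cases zs)
      case Nil
      then show ?thesis using cell_path_length[OF \<beta> cyc] by simp
    next
      case (Cons e es)
      \<comment> \<open>The fourth vertex of the cell is \<open>e\<close>; the strict inequality for
        \<open>d a e\<close> is inherited because \<open>d a e = d a c - d c e\<close>.\<close>
      have "d c a = d c e + d e a" using geodesic_through[OF g, of e] Cons by simp
      then have "d a e < d a b + d b c + d c e"
        using 3(2) d_sym[of c a] d_sym[of e a] d_nonneg[of c e] by linarith
      moreover have "geodesic p d (e # es @ [a])"
        using geodesic_split(2)[of "[c]" e "es @ [a]"] g Cons by simp
      ultimately show ?thesis using cell_path_length[OF \<beta> cyc] Cons by simp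
    qed
    then have "\<beta> $ (a, b) + \<beta> $ (b, c) + path_length (\<lambda>u v. \<beta> $ (u, v)) (c # zs @ [a]) = 0" by simp
    moreover have "- d c a \<le> path_length (\<lambda>u v. \<beta> $ (u, v)) (c # zs @ [a])"
      using path_length_ge[OF form le gp] g by (simp add: geodesic_def)
    ultimately show ?thesis using d_sym[of c a] by simp
  qed
qed

text \<open>The strict inequality in the definition of the 2-cells is exactly the case in which the
  termwise bound is too weak; the cell closed by a geodesic from \<open>v\<close> back to
  \<open>u\<close> then gives the bound. Allowing \<open>u = x\<close> and \<open>v = y\<close>
  covers whole closed balls around \<open>x\<close> and \<open>y\<close>.\<close>

lemma three_edge_bound:
  assumes \<beta>: "\<beta> \<in> ker_coboundary1 p d" and le: "\<And>u v. adj p u v \<Longrightarrow> \<beta> $ (u, v) \<le> d u v"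
    and xy: "adj p x y" and u: "u = x \<or> adj p u x" and v: "v = y \<or> adj p y v"
  shows "\<beta> $ (u, x) + \<beta> $ (x, y) + \<beta> $ (y, v) \<le> d u v"
proof -
  have form: "\<beta> \<in> one_forms p" using \<beta> by (simp add: ker_coboundary1_def)
  have ux: "\<beta> $ (u, x) \<le> d u x" and yv: "\<beta> $ (y, v) \<le> d y v"
    using u v le one_forms_diag[OF form] d_nonneg by (metis)+
  have xyv: "\<beta> $ (x, y) + \<beta> $ (y, v) \<le> d x v"
    using v two_edge_bound[OF \<beta> le xy] le[OF xy] one_forms_diag[OF form, of y] by auto
  have uxy: "\<beta> $ (u, x) + \<beta> $ (x, y) \<le> d u y"
    using u two_edge_bound[OF \<beta> le _ xy] le[OF xy] one_forms_diag[OF form, of x] by auto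
  consider "u = v" | "d u v = d u x + d x y + d y v"
    | "u \<noteq> v" "d u v < d u x + d x y + d y v"
    using d_triangle[of u v x] d_triangle[of x v y] by linarith
  then show ?thesis
  proof cases
    case 1
    \<comment> \<open>The closed walk either backtracks along one edge or runs around a triangle, so
      the sum is 0.\<close>
    consider "u = x" | "u = y" | "adj p u x" "adj p y u" using u v 1 by auto
    then show ?thesis
    proof cases
      case a: 3
      from triangle_sum[OF \<beta> a(1) xy a(2)] show ?thesis using 1 d_nonneg by simp
    qed (use 1 form one_forms_diag one_forms_antisym[of \<beta> x y] d_nonneg in auto)
  next
    case 2
    then show ?thesis using ux yv le[OF xy] by simp
  next
    case 3
    obtain zs where g: "geodesic p d (v # zs @ [u])" using ex_geodesic 3(1) by metis
    have succ: "successively (adj p) ((v # zs) @ [u])" and gp: "graph_path p (v # zs @ [u])"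
      using g by (auto simp: geodesic_def graph_path_def)
    \<comment> \<open>If the geodesic meets \<open>x\<close> or \<open>y\<close>, in particular if
      \<open>u = x\<close> or \<open>v = y\<close>, the distance splits there and the bounds for one
      and two edges add up. Otherwise the cycle has distinct vertices.\<close>
    consider "x \<in> set (v # zs @ [u])" | "y \<in> set (v # zs @ [u])"
      | "x \<notin> set (v # zs @ [u])" "y \<notin> set (v # zs @ [u])" by blast
    then show ?thesis
    proof cases
      case 1
      then have "d v u = d v x + d x u" using geodesic_through[OF g] by simp
      then show ?thesis using ux xyv d_sym[of v u] d_sym[of v x] d_sym[of x u] by linarith
    next
      case 2
      then have "d v u = d v y + d y u" using geodesic_through[OF g] by simp
      then show ?thesis using yv uxy d_sym[of v u] d_sym[of v y] d_sym[of y u] by linarith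
    next
      case out: 3
      have cyc: "is_cycle p (u # x # y # v # zs)"
        using geodesic_distinct[OF g] out succ u v xy
        unfolding is_cycle_def successively_append_iff by (auto simp: adj_def)
      have "path_length (\<lambda>u v. \<beta> $ (u, v)) ((u # x # y # v # zs) @ [hd (u # x # y # v # zs)]) = 0"
        using cell_path_length[OF \<beta> cyc] g 3(2) by simp
      moreover have "- d v u \<le> path_length (\<lambda>u v. \<beta> $ (u, v)) (v # zs @ [u])"
        using path_length_ge[OF form le gp] g by (simp add: geodesic_def)
      ultimately show ?thesis using d_sym[of v u] by simp
    qed
  qed
qed

section \<open>Curvature tested on Lipschitz functions\<close>

lemma gradient_normD:
  assumes "gradient_norm d f = 1"
  shows "\<bar>f x - f y\<bar> \<le> d x y"
proof (cases "x = y")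
  case False
  have "{\<bar>gradient d f x y\<bar> |x y. x \<noteq> y} \<subseteq> range (\<lambda>(x, y). \<bar>gradient d f x y\<bar>)" by auto
  then have "bdd_above {\<bar>gradient d f x y\<bar> |x y. x \<noteq> y}"
    by (meson bdd_above_finite finite finite_imageI finite_subset)
  then have "\<bar>gradient d f x y\<bar> \<le> gradient_norm d f"
    unfolding gradient_norm_def using False by (intro cSup_upper) auto
  then show ?thesis using assms d_pos[OF False] by (simp add: gradient_def field_simps)
qed (simp add: d_nonneg)

lemma gradient_normI:
  assumes lip: "\<And>x y. f x - f y \<le> d x y" and "f x - f y = d x y" and "x \<noteq> y"
  shows "gradient_norm d f = 1"
  unfolding gradient_norm_def
proof (rule cSup_eq_maximum)
  have "\<bar>gradient d f x y\<bar> = 1" using assms(2,3) d_nonneg[of x y] by (simp add: gradient_def)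
  then show "1 \<in> {\<bar>gradient d f x y\<bar> |x y. x \<noteq> y}" using assms(3) by force
next
  fix r assume "r \<in> {\<bar>gradient d f x y\<bar> |x y. x \<noteq> y}"
  then obtain u v where r: "r = \<bar>gradient d f u v\<bar>" "u \<noteq> v" by blast
  have "\<bar>f u - f v\<bar> \<le> d u v" using lip[of u v] lip[of v u] d_sym[of u v] by linarith
  then show "r \<le> 1" using r d_pos[OF r(2)] by (simp add: gradient_def)
qed

lemma laplacian_uminus: "laplacian p (\<lambda>z. - f z) x = - laplacian p f x"
  unfolding laplacian_def sum_negf[symmetric] by (intro sum.cong) (auto simp: algebra_simps)

text \<open>The definition asks for functions that increase from \<open>x\<close> to
  \<open>y\<close>, so the test function is \<open>- f\<close>.\<close>

lemma ollivier_curvature_le: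
  assumes lip: "\<And>u v. f u - f v \<le> d u v" and fxy: "f x - f y = d x y" and "x \<noteq> y"
  shows "ollivier_curvature p d x y * d x y \<le> laplacian p f y - laplacian p f x"
proof -
  define g where "g z = - f z" for z
  have lap: "laplacian p g z = - laplacian p f z" for z
    unfolding g_def by (rule laplacian_uminus)
  have "g u - g v \<le> d u v" for u v using lip[of v u] d_sym[of u v] by (simp add: g_def)
  moreover have gyx: "g y - g x = d y x" using fxy d_sym[of y x] by (simp add: g_def)
  ultimately have norm: "gradient_norm d g = 1" using assms(3) by (intro gradient_normI[of g y x]) auto
  have grad: "gradient d g y x = 1" using gyx d_pos[of y x] assms(3) by (simp add: gradient_def)
  \<comment> \<open>Lipschitz functions have Laplacians bounded by the mean jump length, so the
    infimum is over a set bounded below.\<close>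
  define C where "C = (\<Sum>z\<in>UNIV. p x z * d z x) + (\<Sum>z\<in>UNIV. p y z * d z y)"
  have bdd: "bdd_below {gradient d (laplacian p h) x y |h. gradient d h y x = 1 \<and> gradient_norm d h = 1}"
  proof (rule bdd_belowI)
    fix r assume "r \<in> {gradient d (laplacian p h) x y |h. gradient d h y x = 1 \<and> gradient_norm d h = 1}"
    then obtain h where r: "r = gradient d (laplacian p h) x y" and h: "gradient_norm d h = 1" by blast
    have "\<bar>laplacian p h a\<bar> \<le> (\<Sum>z\<in>UNIV. p a z * d z a)" for a
      unfolding laplacian_def
    proof (rule order_trans[OF sum_abs sum_mono])
      show "\<bar>p a z * (h z - h a)\<bar> \<le> p a z * d z a" for z
        using mult_left_mono[OF gradient_normD[OF h, of z a] p_nonneg[of a z]] p_nonneg[of a z]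
        by (simp add: abs_mult)
    qed
    from this[of x] this[of y] have "- C \<le> laplacian p h x - laplacian p h y"
      unfolding C_def by linarith
    then show "- C / d x y \<le> r" unfolding r gradient_def
      using d_nonneg[of x y] by (intro divide_right_mono) auto
  qed
  have "ollivier_curvature p d x y \<le> gradient d (laplacian p g) x y"
    unfolding ollivier_curvature_def using grad norm by (intro cInf_lower bdd) auto
  then show ?thesis using d_pos[OF assms(3)] by (simp add: gradient_def lap field_simps)
qed

definition divergence :: "real ^ ('v \<times> 'v) \<Rightarrow> 'v \<Rightarrow> real" where
  "divergence \<beta> x = (\<Sum>y\<in>UNIV. p x y * \<beta> $ (x, y))"

text \<open>On the closed ball \<open>B\<close> around \<open>y\<close> the function
  \<open>\<beta> $ (v, y)\<close> is a primitive of \<open>\<beta>\<close> along the edges at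
  \<open>y\<close>. Its McShane extension \<open>F\<close> is 1-Lipschitz and lies below it on
  \<open>B\<close>, while the three-edge bound keeps \<open>F\<close> above the corresponding
  primitive around \<open>x\<close>. This compares both Laplacians of \<open>F\<close> with
  divergences of \<open>\<beta>\<close>.\<close>

lemma divergence_diff_ge_curvature:
  assumes \<beta>: "\<beta> \<in> ker_coboundary1 p d" and le: "\<And>u v. adj p u v \<Longrightarrow> \<beta> $ (u, v) \<le> d u v"
    and xy: "adj p x y" and max: "\<beta> $ (x, y) = d x y"
  shows "ollivier_curvature p d x y * d x y \<le> divergence \<beta> x - divergence \<beta> y"
proof -
  have form: "\<beta> \<in> one_forms p" using \<beta> by (simp add: ker_coboundary1_def)
  define B where "B = {v. v = y \<or> adj p y v}"
  define F where "F z = Min ((\<lambda>v. \<beta> $ (v, y) + d z v) ` B)" for z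
  have yB: "y \<in> B" by (simp add: B_def)
  have F_le: "F z \<le> \<beta> $ (v, y) + d z v" if "v \<in> B" for z v
    unfolding F_def using that by (intro Min_le) auto
  have F_ge: "t \<le> F z" if "\<And>v. v \<in> B \<Longrightarrow> t \<le> \<beta> $ (v, y) + d z v" for t z
    unfolding F_def using that yB by (subst Min_ge_iff) auto
  have lip: "F u - F v \<le> d u v" for u v
  proof -
    have "F u - d u v \<le> F v"
    proof (rule F_ge)
      fix w assume "w \<in> B"
      from F_le[OF this, of u] show "F u - d u v \<le> \<beta> $ (w, y) + d v w"
        using d_triangle[of u w v] by linarith
    qed
    then show ?thesis by simp
  qed
  have near: "\<beta> $ (u, x) + d x y \<le> F u" if "u = x \<or> adj p u x" for u
  proof (rule F_ge)
    fix v assume "v \<in> B"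
    then have "\<beta> $ (u, x) + \<beta> $ (x, y) + \<beta> $ (y, v) \<le> d u v"
      using three_edge_bound[OF \<beta> le xy that] by (simp add: B_def)
    then show "\<beta> $ (u, x) + d x y \<le> \<beta> $ (v, y) + d u v"
      using one_forms_antisym[OF form, of v y] max by simp
  qed
  have Fx: "F x = d x y"
    using near[of x] F_le[OF yB, of x] one_forms_diag[OF form] by simp
  have "0 \<le> F y"
  proof (rule F_ge)
    fix v assume "v \<in> B"
    then show "0 \<le> \<beta> $ (v, y) + d y v"
      using le[of y v] one_forms_antisym[OF form, of v y] one_forms_diag[OF form, of y] by (auto simp: B_def)
  qed
  then have Fy: "F y = 0" using F_le[OF yB, of y] one_forms_diag[OF form, of y] by simp
  have "x \<noteq> y" using xy by (simp add: adj_def)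
  then have curv: "ollivier_curvature p d x y * d x y \<le> laplacian p F y - laplacian p F x"
    using lip Fx Fy by (intro ollivier_curvature_le) auto
  have "- divergence \<beta> x \<le> laplacian p F x"
    unfolding divergence_def laplacian_def sum_negf[symmetric]
  proof (rule sum_mono)
    fix u
    have "p x u = 0 \<or> u = x \<or> adj p u x"
      using adj_sym[of x u] p_nonneg[of x u] by (auto simp: adj_def)
    then show "- (p x u * \<beta> $ (x, u)) \<le> p x u * (F u - F x)"
    proof
      assume "u = x \<or> adj p u x"
      then have "- \<beta> $ (x, u) \<le> F u - F x"
        using near[of u] Fx one_forms_antisym[OF form, of u x] by simp
      from mult_left_mono[OF this p_nonneg[of x u]] show ?thesis by simp
    qed simp
  qed
  moreover have "laplacian p F y \<le> - divergence \<beta> y"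
    unfolding divergence_def laplacian_def sum_negf[symmetric]
  proof (rule sum_mono)
    fix v
    have "p y v = 0 \<or> v \<in> B" using p_nonneg[of y v] by (auto simp: adj_def B_def)
    then show "p y v * (F v - F y) \<le> - (p y v * \<beta> $ (y, v))"
    proof
      assume "v \<in> B"
      then have "F v - F y \<le> - \<beta> $ (y, v)"
        using F_le[of v v] Fy one_forms_antisym[OF form, of v y] by simp
      from mult_left_mono[OF this p_nonneg[of y v]] show ?thesis by simp
    qed simp
  qed
  ultimately show ?thesis using curv by linarith
qed

section \<open>Divergence, maximum principle and Poisson equation\<close>

lemma divergence_diff: "divergence (\<beta> - \<gamma>) x = divergence \<beta> x - divergence \<gamma> x"
  by (simp add: divergence_def right_diff_distrib sum_subtractf)

lemma divergence_scale: "divergence (r *\<^sub>R \<beta>) x = r * divergence \<beta> x"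
  by (simp add: divergence_def sum_distrib_left mult.left_commute)

lemma divergence_coboundary0: "divergence (coboundary0 p g) x = - laplacian p g x"
  unfolding divergence_def laplacian_def sum_negf[symmetric]
proof (rule sum.cong)
  fix y
  show "p x y * coboundary0 p g $ (x, y) = - (p x y * (g y - g x))"
    using p_nonneg[of x y] by (auto simp: coboundary0_def adj_def algebra_simps)
qed simp

lemma coboundary0_in_ker: "coboundary0 p g \<in> ker_coboundary1 p d"
  using im_coboundary0_subset_ker_coboundary1[OF symmetric] by (auto simp: im_coboundary0_def)

lemma closed_under_positive_transitions:
  assumes "x \<in> S" and "\<And>u v. u \<in> S \<Longrightarrow> 0 < p u v \<Longrightarrow> v \<in> S"
  shows "S = UNIV"
proof -
  have "y \<in> S" for y
  proof -
    have "(\<lambda>u v. p u v > 0)\<^sup>*\<^sup>* x y" using irreducible by (simp add: irreducible_chain_def)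
    then show ?thesis by (induction rule: rtranclp_induct) (use assms in auto)
  qed
  then show ?thesis by blast
qed

lemma laplacian_nonpos_at_max:
  assumes "\<And>z. f z \<le> f x"
  shows "laplacian p f x \<le> 0"
    and "laplacian p f x = 0 \<Longrightarrow> 0 < p x y \<Longrightarrow> f y = f x"
proof -
  have le: "p x z * (f z - f x) \<le> 0" for z
    using assms[of z] p_nonneg[of x z] by (simp add: mult_nonneg_nonpos)
  then show "laplacian p f x \<le> 0" unfolding laplacian_def by (simp add: sum_nonpos)
  assume "laplacian p f x = 0" "0 < p x y"
  then have "(\<Sum>z\<in>UNIV. - (p x z * (f z - f x))) = 0" by (simp add: laplacian_def sum_negf)
  then have "p x y * (f y - f x) = 0"
    using le by (subst (asm) sum_nonneg_eq_0_iff) (auto simp: algebra_simps)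
  then show "f y = f x" using \<open>0 < p x y\<close> by simp
qed

text \<open>The signs of the Laplacian at a maximum and at a minimum force \<open>c = 0\<close>;
  then the set of maximum points is closed under transitions and irreducibility makes it
  everything.\<close>

lemma laplacian_constant:
  assumes "\<And>x. laplacian p f x = c"
  shows "c = 0" and "f x = f y"
proof -
  have fin: "finite (range f)" "range f \<noteq> {}" by auto
  obtain a where a: "f a = Max (range f)" using Max_in[OF fin] by (metis imageE)
  obtain b where b: "f b = Min (range f)" using Min_in[OF fin] by (metis imageE)
  have fa: "f z \<le> f a" and fb: "f b \<le> f z" for z unfolding a b using fin by auto
  have "c \<le> 0" using laplacian_nonpos_at_max(1)[of f a] fa assms by simp
  moreover have "- c \<le> 0"
    using laplacian_nonpos_at_max(1)[of "\<lambda>z. - f z" b] fb assms by (simp add: laplacian_uminus)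
  ultimately show c: "c = 0" by simp
  have "{z. f z = f a} = UNIV"
  proof (rule closed_under_positive_transitions[of a])
    fix u v assume u: "u \<in> {z. f z = f a}" and "0 < p u v"
    then have "f v = f u" using fa assms c by (intro laplacian_nonpos_at_max(2)) auto
    then show "v \<in> {z. f z = f a}" using u by simp
  qed simp
  then have "f z = f a" for z by auto
  then show "f x = f y" by metis
qed

lemma poisson_solvable_mod_constants: "\<exists>f c. \<forall>x. laplacian p f x = h x + c"
proof -
  obtain o' :: 'v where True by blast
  \<comment> \<open>The value at a base vertex is added to remove the constants from the kernel of
    the Laplacian. \<open>T\<close> becomes injective, hence surjective, and the added value
    supplies the constant \<open>c\<close>.\<close>
  define T :: "real ^ 'v \<Rightarrow> real ^ 'v" where "T f = (\<chi> x. laplacian p (\<lambda>y. f $ y) x + f $ o')" for f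
  have lin: "linear T"
    by (rule linearI)
      (auto simp: T_def laplacian_def vec_eq_iff algebra_simps sum.distrib sum_subtractf sum_distrib_left)
  moreover have "inj T"
  proof (subst linear_injective_0[OF lin], intro allI impI)
    fix f assume "T f = 0"
    then have eq: "laplacian p (\<lambda>y. f $ y) x = - f $ o'" for x
      by (simp add: T_def vec_eq_iff add_eq_0_iff2)
    have "f $ o' = 0" using laplacian_constant(1)[OF eq] by simp
    moreover have "f $ x = f $ o'" for x by (rule laplacian_constant(2)[OF eq])
    ultimately show "f = 0" by (simp add: vec_eq_iff)
  qed
  ultimately have "surj T" by (intro linear_injective_imp_surjective refl)
  then obtain f where "T f = (\<chi> x. h x)" by (metis surjD)
  then have "laplacian p (\<lambda>y. f $ y) x = h x + - f $ o'" for x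
    by (simp add: T_def vec_eq_iff eq_diff_eq)
  then show ?thesis by blast
qed

end

section \<open>Maximal edges of a form of constant divergence\<close>

locale extremal_harmonic_form = path_metric_chain p d
  for p d :: "'v::finite \<Rightarrow> 'v \<Rightarrow> real" +
  fixes \<alpha> :: "real ^ ('v \<times> 'v)" and c :: real
  assumes nonneg_curvature: "nonneg_ollivier_curvature p d"
    and closed: "\<alpha> \<in> ker_coboundary1 p d"
    and bounded: "adj p u v \<Longrightarrow> \<alpha> $ (u, v) \<le> d u v"
    and harmonic: "divergence \<alpha> x = c"
begin

definition max_edges :: "('v \<times> 'v) set" where
  "max_edges = {(u, v). adj p u v \<and> \<alpha> $ (u, v) = d u v}"

lemma max_edges_curvature:
  assumes "(x, y) \<in> max_edges"
  shows "ollivier_curvature p d x y \<le> 0"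
proof -
  have xy: "adj p x y" "\<alpha> $ (x, y) = d x y" using assms by (auto simp: max_edges_def)
  have "ollivier_curvature p d x y * d x y \<le> 0"
    using divergence_diff_ge_curvature[OF closed bounded xy] harmonic by simp
  then show ?thesis using adj_d_pos[OF xy(1)] by (simp add: mult_le_0_iff)
qed

text \<open>First variation of the sup norm at \<open>\<alpha>\<close> in the direction of the exact form of \<open>g\<close>: for small
  \<open>\<epsilon> > 0\<close> the form \<open>\<alpha> - \<epsilon> \<delta>\<^sub>0 g\<close> has norm \<open>1 - \<epsilon> m\<close>, attained at \<open>(x, y)\<close>.\<close>

lemma laplacian_le_along_max_edge:
  assumes g: "\<And>u v. (u, v) \<in> max_edges \<Longrightarrow> m * d u v \<le> g u - g v"
    and xy: "(x, y) \<in> max_edges" and eq: "g x - g y = m * d x y"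
  shows "laplacian p g y \<le> laplacian p g x"
proof -
  \<comment> \<open>Off \<open>max_edges\<close> the inequality is strict at
    \<open>\<epsilon> = 0\<close> and persists by continuity; on \<open>max_edges\<close> it follows
    from the hypothesis on \<open>g\<close> for every \<open>\<epsilon> > 0\<close>. Finitely many
    edges share one \<open>\<epsilon>\<close>.\<close>
  have ev: "\<forall>\<^sub>F \<epsilon> in at_right (0::real). adj p u v \<longrightarrow> \<alpha> $ (u, v) - \<epsilon> * (g u - g v) \<le> (1 - \<epsilon> * m) * d u v" for u v
  proof (cases "adj p u v \<and> \<alpha> $ (u, v) \<noteq> d u v")
    case True
    then have lt: "\<alpha> $ (u, v) < d u v" using bounded[of u v] by simp
    have "((\<lambda>\<epsilon>. (1 - \<epsilon> * m) * d u v - (\<alpha> $ (u, v) - \<epsilon> * (g u - g v))) \<longlongrightarrow>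
        (1 - 0 * m) * d u v - (\<alpha> $ (u, v) - 0 * (g u - g v))) (at_right 0)"
      by (intro tendsto_intros)
    then have "\<forall>\<^sub>F \<epsilon> in at_right 0. 0 < (1 - \<epsilon> * m) * d u v - (\<alpha> $ (u, v) - \<epsilon> * (g u - g v))"
      by (rule order_tendstoD(1)) (use lt in simp)
    then show ?thesis by eventually_elim (rule impI, linarith)
  next
    case False
    show ?thesis
      using eventually_at_right_less[of "0::real"]
    proof eventually_elim
      case (elim \<epsilon>)
      show ?case
      proof
        assume "adj p u v"
        then have uv: "(u, v) \<in> max_edges" "\<alpha> $ (u, v) = d u v" using False by (auto simp: max_edges_def)
        have "\<epsilon> * (m * d u v) \<le> \<epsilon> * (g u - g v)" using g[OF uv(1)] elim by (intro mult_left_mono) auto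
        moreover have "(1 - \<epsilon> * m) * d u v = d u v - \<epsilon> * (m * d u v)" by (simp add: algebra_simps)
        ultimately show "\<alpha> $ (u, v) - \<epsilon> * (g u - g v) \<le> (1 - \<epsilon> * m) * d u v"
          using uv(2) by linarith
      qed
    qed
  qed
  have "((\<lambda>\<epsilon>. 1 - \<epsilon> * m) \<longlongrightarrow> 1 - 0 * m) (at_right 0)" by (intro tendsto_intros)
  then have "\<forall>\<^sub>F \<epsilon> in at_right 0. 0 < 1 - \<epsilon> * m" by (rule order_tendstoD(1)) simp
  moreover have "\<forall>\<^sub>F \<epsilon> in at_right (0::real). \<forall>u v. adj p u v \<longrightarrow>
      \<alpha> $ (u, v) - \<epsilon> * (g u - g v) \<le> (1 - \<epsilon> * m) * d u v"
    using ev by (intro eventually_all_finite)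
  ultimately have "\<forall>\<^sub>F \<epsilon> in at_right (0::real). 0 < \<epsilon> \<and> 0 < 1 - \<epsilon> * m \<and>
      (\<forall>u v. adj p u v \<longrightarrow> \<alpha> $ (u, v) - \<epsilon> * (g u - g v) \<le> (1 - \<epsilon> * m) * d u v)"
    using eventually_at_right_less[of "0::real"] by eventually_elim auto
  then have "\<exists>\<epsilon>. 0 < \<epsilon> \<and> 0 < 1 - \<epsilon> * m \<and>
      (\<forall>u v. adj p u v \<longrightarrow> \<alpha> $ (u, v) - \<epsilon> * (g u - g v) \<le> (1 - \<epsilon> * m) * d u v)"
    by (rule eventually_happens'[rotated]) simp
  then obtain \<epsilon> :: real where \<epsilon>: "0 < \<epsilon>" "0 < 1 - \<epsilon> * m"
    and le: "\<And>u v. adj p u v \<Longrightarrow> \<alpha> $ (u, v) - \<epsilon> * (g u - g v) \<le> (1 - \<epsilon> * m) * d u v"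
    by blast
  define M where "M = 1 - \<epsilon> * m"
  define \<beta> where "\<beta> = (1 / M) *\<^sub>R (\<alpha> - \<epsilon> *\<^sub>R coboundary0 p g)"
  have M: "0 < M" using \<epsilon> by (simp add: M_def)
  have "\<beta> \<in> ker_coboundary1 p d"
    unfolding \<beta>_def using closed coboundary0_in_ker subspace_ker_coboundary1
    by (intro subspace_scale subspace_diff) auto
  moreover have \<beta>_edge: "\<beta> $ (u, v) = (\<alpha> $ (u, v) - \<epsilon> * (g u - g v)) / M" if "adj p u v" for u v
    using that by (simp add: \<beta>_def coboundary0_def)
  moreover have "\<beta> $ (u, v) \<le> d u v" if "adj p u v" for u v
    using le[OF that, folded M_def] M unfolding \<beta>_edge[OF that]
    by (simp add: pos_divide_le_eq mult.commute)
  moreover have adj: "adj p x y" using xy by (simp add: max_edges_def)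
  moreover have "\<alpha> $ (x, y) - \<epsilon> * (g x - g y) = M * d x y"
    using xy unfolding eq M_def by (simp add: max_edges_def algebra_simps)
  then have "\<beta> $ (x, y) = d x y" using \<beta>_edge[OF adj] M by simp
  ultimately have "ollivier_curvature p d x y * d x y \<le> divergence \<beta> x - divergence \<beta> y"
    by (intro divergence_diff_ge_curvature)
  moreover have "0 \<le> ollivier_curvature p d x y * d x y"
    using nonneg_curvature adj d_nonneg by (simp add: nonneg_ollivier_curvature_def)
  moreover have "divergence \<beta> z = (c + \<epsilon> * laplacian p g z) / M" for z
    by (simp add: \<beta>_def divergence_scale divergence_diff divergence_coboundary0 harmonic)
  ultimately have "(c + \<epsilon> * laplacian p g y) / M \<le> (c + \<epsilon> * laplacian p g x) / M" by simp
  then show ?thesis using M \<epsilon>(1) by (simp add: divide_le_cancel)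
qed

text \<open>For the longest-path potential \<open>D\<close>, following tight edges never increases
  the Laplacian and ends at a zero of \<open>D\<close>. Starting at a maximum of \<open>D\<close>,
  where the Laplacian is negative, this contradicts its sign at a minimum.\<close>

lemma max_edges_not_acyclic:
  assumes ne: "max_edges \<noteq> {}"
  shows "\<not> acyclic max_edges"
proof
  assume "acyclic max_edges"
  then have wf: "wf (max_edges\<inverse>)" by (intro finite_acyclic_wf_converse) auto
  obtain D where D: "\<And>v. 0 \<le> D v" "\<And>v w. (v, w) \<in> max_edges \<Longrightarrow> d v w \<le> D v - D w"
    and tight: "\<And>v. D v \<noteq> 0 \<Longrightarrow> \<exists>w. (v, w) \<in> max_edges \<and> D v - D w = d v w"
    by (rule wf_longest_path[OF wf, of d]) (rule that)
  have sink: "\<exists>w. D w = 0 \<and> laplacian p D w \<le> laplacian p D v" for v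
  proof (induction v rule: wf_induct_rule[OF wf])
    case (1 v)
    show ?case
    proof (cases "D v = 0")
      case False
      then obtain u where u: "(v, u) \<in> max_edges" "D v - D u = d v u" using tight by blast
      then obtain w where "D w = 0" "laplacian p D w \<le> laplacian p D u" using 1[of u] by auto
      moreover have "laplacian p D u \<le> laplacian p D v"
        using D(2) u by (intro laplacian_le_along_max_edge[of 1]) auto
      ultimately show ?thesis by (intro exI[of _ w]) simp
    qed auto
  qed
  have fin: "finite (range D)" "range D \<noteq> {}" by auto
  obtain a where a: "D a = Max (range D)" using Max_in[OF fin] by (metis imageE)
  have Da: "D z \<le> D a" for z unfolding a using fin by auto
  obtain x y where xy: "(x, y) \<in> max_edges" using ne by auto
  then have "0 < d x y" by (auto simp: max_edges_def intro: adj_d_pos)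
  then have "D a \<noteq> 0" using D(1)[of y] D(2)[OF xy] Da[of x] by linarith
  then obtain b where b: "(a, b) \<in> max_edges" "D a - D b = d a b" using tight by blast
  then have ab: "adj p a b" by (simp add: max_edges_def)
  have "D b \<noteq> D a" using b(2) adj_d_pos[OF ab] by simp
  moreover have "0 < p a b" using ab by (simp add: adj_def)
  \<comment> \<open>A zero Laplacian at the maximum \<open>a\<close> would force
    \<open>D b = D a\<close> at the neighbour \<open>b\<close>.\<close>
  ultimately have "laplacian p D a \<noteq> 0" using laplacian_nonpos_at_max(2)[of D a b, OF Da] by metis
  then have "laplacian p D a < 0" using laplacian_nonpos_at_max(1)[of D a, OF Da] by simp
  moreover obtain w where w: "D w = 0" "laplacian p D w \<le> laplacian p D a" using sink by blast
  moreover have "0 \<le> laplacian p D w"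
    unfolding laplacian_def using w(1) D(1) p_nonneg by (intro sum_nonneg) auto
  ultimately show False by simp
qed

text \<open>For \<open>g = - 1\<close> on \<open>T\<close> and 0 elsewhere, forward closedness says
  that \<open>g\<close> does not increase along maximal edges, so \<open>m = 0\<close> is admissible
  and is attained on edges outside \<open>T\<close>. There the Laplacian of \<open>g\<close> is
  minus the transition mass into \<open>T\<close>.\<close>

lemma transition_mass_mono:
  assumes T: "\<And>u v. u \<in> T \<Longrightarrow> (u, v) \<in> max_edges \<Longrightarrow> v \<in> T"
    and "(x, y) \<in> max_edges\<^sup>*" and "y \<notin> T"
  shows "sum (p x) T \<le> sum (p y) T"
  using assms(2)
proof (induction rule: converse_rtrancl_induct)
  case (step u v)
  have out: "w \<notin> T" if "(w, y) \<in> max_edges\<^sup>*" for w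
    using that \<open>y \<notin> T\<close> by (induction rule: converse_rtrancl_induct) (use T in blast)+
  have u: "u \<notin> T" and v: "v \<notin> T" using out step by (meson converse_rtrancl_into_rtrancl)+
  define g :: "'v \<Rightarrow> real" where "g z = - indicator T z" for z
  have lap: "laplacian p g w = - sum (p w) T" if "w \<notin> T" for w
  proof -
    have "laplacian p g w = (\<Sum>z\<in>UNIV. - (if z \<in> T then p w z else 0))"
      unfolding laplacian_def using that by (intro sum.cong) (auto simp: g_def)
    then show ?thesis by (simp add: sum_negf sum.If_cases)
  qed
  have "laplacian p g v \<le> laplacian p g u"
    using T u v step(1)
    by (intro laplacian_le_along_max_edge[of 0]) (auto simp: g_def indicator_def)
  then show ?case using lap[OF u] lap[OF v] step.IH by simp
qed simp

section \<open>Vertices that lead to a cycle of maximal edges\<close>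

definition reach_cycle :: "'v set" where
  "reach_cycle = {v. \<exists>z. (v, z) \<in> max_edges\<^sup>* \<and> (z, z) \<in> max_edges\<^sup>+}"

lemma reach_cycle_backward:
  assumes "(a, b) \<in> max_edges\<^sup>*" and "b \<in> reach_cycle"
  shows "a \<in> reach_cycle"
proof -
  obtain z where "(b, z) \<in> max_edges\<^sup>*" "(z, z) \<in> max_edges\<^sup>+"
    using assms(2) unfolding reach_cycle_def by blast
  then show ?thesis using rtrancl_trans[OF assms(1)] unfolding reach_cycle_def by blast
qed

text \<open>A neighbour \<open>w\<close> that leads to no cycle would pass on to the cycle through
  \<open>z\<close> a vertex \<open>t\<close> of the same kind, adjacent to the whole cycle. By the
  triangles, \<open>\<alpha> $ (u, t)\<close> would then decrease strictly as \<open>u\<close> runs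
  once around the cycle.\<close>

lemma reach_cycle_step:
  assumes "v \<in> reach_cycle" and vw: "0 < p v w"
  shows "w \<in> reach_cycle"
proof (rule ccontr)
  assume w: "w \<notin> reach_cycle"
  obtain z where z: "(v, z) \<in> max_edges\<^sup>*" "(z, z) \<in> max_edges\<^sup>+"
    using assms(1) unfolding reach_cycle_def by blast
  have z_in: "z \<in> reach_cycle" using z(2) unfolding reach_cycle_def by blast
  define T where "T x = {t. (x, t) \<in> max_edges\<^sup>*}" for x
  have T: "b \<in> T x" if "a \<in> T x" "(a, b) \<in> max_edges" for a b x
    using that rtrancl_into_rtrancl[of x a _ b] by (simp add: T_def)
  have "z \<notin> T w" using w z_in reach_cycle_backward[of w z] by (auto simp: T_def)
  then have "sum (p v) (T w) \<le> sum (p z) (T w)"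
    using T by (intro transition_mass_mono z(1))
  moreover have "p v w \<le> sum (p v) (T w)"
    using p_nonneg by (intro member_le_sum) (auto simp: T_def)
  ultimately have "sum (p z) (T w) \<noteq> 0" using vw by linarith
  then obtain t where t: "t \<in> T w" "p z t \<noteq> 0" by (meson sum.neutral)
  have t_out: "t \<notin> reach_cycle"
    using t(1) w reach_cycle_backward[of w t] by (auto simp: T_def)
  have z_out: "z \<notin> T t" using t_out z_in reach_cycle_backward[of t z] by (auto simp: T_def)
  \<comment> \<open>Removing \<open>t\<close> keeps the set forward closed, since no cycle of
    maximal edges passes through \<open>t\<close>.\<close>
  have T_del: "b \<in> T t - {t}" if "a \<in> T t - {t}" "(a, b) \<in> max_edges" for a b
  proof -
    have tb: "(t, b) \<in> max_edges\<^sup>+" using that rtrancl_into_trancl1[of t a _ b] by (simp add: T_def)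
    then have "b \<noteq> t" using t_out unfolding reach_cycle_def by blast
    then show ?thesis using tb by (simp add: T_def trancl_into_rtrancl)
  qed
  text \<open>The transition mass into \<open>T t\<close> and into \<open>T t - {t}\<close> is constant along the cycle through
    \<open>z\<close>, hence so is the transition probability to \<open>t\<close>.\<close>
  have cone: "adj p u t" if u: "(z, u) \<in> max_edges\<^sup>*" "(u, z) \<in> max_edges\<^sup>*" for u
  proof -
    have u_out: "u \<notin> T t" using z_out rtrancl_trans[OF _ u(2), of t] by (auto simp: T_def)
    have split: "sum (p x) (T t) = p x t + sum (p x) (T t - {t})" for x
      by (intro sum.remove) (auto simp: T_def)
    have "sum (p z) (T t) \<le> sum (p u) (T t)" using T u_out by (intro transition_mass_mono u(1))
    moreover have "sum (p u) (T t - {t}) \<le> sum (p z) (T t - {t})"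
    proof (rule transition_mass_mono[OF _ u(2)])
      show "z \<notin> T t - {t}" using z_out by blast
    qed (rule T_del)
    \<comment> \<open>The two masses are compared in opposite directions: into \<open>T t\<close>
      along the path from \<open>z\<close> to \<open>u\<close>, into \<open>T t - {t}\<close> along
      the path back. Subtracting them isolates the transition to \<open>t\<close>.\<close>
    ultimately have "p z t \<le> p u t" using split[of z] split[of u] by linarith
    then have "0 < p u t" using t(2) p_nonneg[of z t] by linarith
    moreover have "u \<noteq> t" using u_out by (auto simp: T_def)
    ultimately show ?thesis by (simp add: adj_def)
  qed
  have form: "\<alpha> \<in> one_forms p" using closed by (simp add: ker_coboundary1_def)
  have drop: "\<alpha> $ (b, t) < \<alpha> $ (a, t)"
    if ab: "(a, b) \<in> max_edges" and za: "(z, a) \<in> max_edges\<^sup>*" and bz: "(b, z) \<in> max_edges\<^sup>*" for a b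
  proof -
    have "adj p a t" by (rule cone[OF za converse_rtrancl_into_rtrancl[OF ab bz]])
    moreover have "adj p b t" by (rule cone[OF rtrancl_into_rtrancl[OF za ab] bz])
    ultimately have "\<alpha> $ (a, b) + \<alpha> $ (b, t) + \<alpha> $ (t, a) = 0"
      using ab adj_sym by (intro triangle_sum[OF closed]) (auto simp: max_edges_def)
    moreover have "0 < \<alpha> $ (a, b)" using ab adj_d_pos by (auto simp: max_edges_def)
    ultimately show ?thesis using one_forms_antisym[OF form, of t a] by simp
  qed
  have "(u, z) \<in> max_edges\<^sup>* \<longrightarrow> \<alpha> $ (u, t) < \<alpha> $ (z, t)" if "(z, u) \<in> max_edges\<^sup>+" for u
    using that
  proof (induction rule: trancl_induct)
    case (base u)
    then show ?case using drop[of z u] by simp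
  next
    case (step a b)
    show ?case
    proof
      assume bz: "(b, z) \<in> max_edges\<^sup>*"
      have "(a, z) \<in> max_edges\<^sup>*" using step(2) bz by (rule converse_rtrancl_into_rtrancl)
      then have "\<alpha> $ (a, t) < \<alpha> $ (z, t)" using step.IH by blast
      with drop[OF step(2) trancl_into_rtrancl[OF step(1)] bz] show "\<alpha> $ (b, t) < \<alpha> $ (z, t)"
        by linarith
    qed
  qed
  from this[OF z(2)] show False by simp
qed

text \<open>\<open>reach_cycle\<close> is nonempty and closed under positive transitions, hence
  contains every vertex. The path to the cycle followed by the cycle has at least one edge, even if
  \<open>x\<close> already lies on the cycle.\<close>

lemma max_edge_at_every_vertex:
  assumes "max_edges \<noteq> {}"
  shows "\<exists>y. (x, y) \<in> max_edges"
proof -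
  obtain z where "(z, z) \<in> max_edges\<^sup>+"
    using max_edges_not_acyclic[OF assms] by (auto simp: acyclic_def)
  then have "z \<in> reach_cycle" by (auto simp: reach_cycle_def)
  then have "reach_cycle = UNIV"
    using reach_cycle_step by (rule closed_under_positive_transitions)
  then obtain w where "(x, w) \<in> max_edges\<^sup>*" "(w, w) \<in> max_edges\<^sup>+"
    by (auto simp: reach_cycle_def)
  then have "(x, w) \<in> max_edges\<^sup>+" by simp
  then show ?thesis by (meson tranclD)
qed

end

section \<open>Vanishing of harmonic forms and of the Betti number\<close>

lemma (in path_metric_chain) harmonic_form_eq_0:
  assumes curv: "nonneg_ollivier_curvature p d"
    and pos: "\<And>y. adj p o' y \<Longrightarrow> 0 < ollivier_curvature p d o' y"
    and \<alpha>: "\<alpha> \<in> ker_coboundary1 p d" and div: "\<And>x. divergence \<alpha> x = c"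
  shows "\<alpha> = 0"
proof (rule ccontr)
  assume "\<alpha> \<noteq> 0"
  then obtain a b where ab: "\<alpha> $ (a, b) \<noteq> 0" by (auto simp: vec_eq_iff)
  have form: "\<alpha> \<in> one_forms p" using \<alpha> by (simp add: ker_coboundary1_def)
  have ab_adj: "adj p a b" using ab form unfolding one_forms_def by blast
  define E where "E = {(u, v). adj p u v}"
  define q where "q e = \<alpha> $ e / d (fst e) (snd e)" for e
  define M where "M = Max (q ` E)"
  have fin: "finite (q ` E)" "q ` E \<noteq> {}" using ab_adj by (auto simp: E_def)
  have q_le: "q (u, v) \<le> M" if "adj p u v" for u v
    unfolding M_def using fin that by (intro Max_ge) (auto simp: E_def)
  \<comment> \<open>One of the two orientations of the edge has a positive quotient, so the maximum
    \<open>M\<close> is positive and can be divided out.\<close>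
  have "q (b, a) = - q (a, b)" using one_forms_antisym[OF form, of b a] d_sym by (simp add: q_def)
  moreover have "q (a, b) \<noteq> 0" using ab ab_adj by (simp add: q_def adj_def)
  ultimately have M: "0 < M" using q_le[OF ab_adj] q_le[OF adj_sym[OF ab_adj]] by linarith
  define \<beta> where "\<beta> = (1 / M) *\<^sub>R \<alpha>"
  interpret extremal_harmonic_form p d \<beta> "c / M"
  proof
    show "nonneg_ollivier_curvature p d" by (rule curv)
    show "\<beta> \<in> ker_coboundary1 p d"
      unfolding \<beta>_def by (intro subspace_scale subspace_ker_coboundary1 \<alpha>)
    show "divergence \<beta> x = c / M" for x by (simp add: \<beta>_def divergence_scale div)
    show "\<beta> $ (u, v) \<le> d u v" if "adj p u v" for u v
      using q_le[OF that] adj_d_pos[OF that] M by (simp add: \<beta>_def q_def field_simps)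
  qed
  obtain e where e: "e \<in> E" "q e = M" using Max_in[OF fin] by (auto simp: M_def)
  then obtain x y where xy: "e = (x, y)" "adj p x y" by (auto simp: E_def)
  have "\<alpha> $ (x, y) = M * d x y"
    using e(2) xy(2) unfolding xy(1) q_def by (auto simp: adj_def)
  then have "\<beta> $ (x, y) = d x y" using M by (simp add: \<beta>_def)
  then have "(x, y) \<in> max_edges" using xy(2) by (simp add: max_edges_def)
  then obtain z where z: "(o', z) \<in> max_edges" using max_edge_at_every_vertex by blast
  then have "adj p o' z" by (simp add: max_edges_def)
  then show False using pos max_edges_curvature[OF z] by fastforce
qed

theorem theorem4p19:
  fixes p d :: "'v::finite \<Rightarrow> 'v \<Rightarrow> real"
  assumes "markov_chain p"
    and "irreducible_chain p"
    and "symmetric_support p"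
    and "general_path_distance p d"
    and "nonneg_ollivier_curvature p d"
    and "\<exists>x. \<forall>y. y \<noteq> x \<and> p x y > 0 \<longrightarrow> ollivier_curvature p d x y > 0"
  shows "betti1 p d = 0"
proof -
  interpret path_metric_chain p d by unfold_locales (fact assms)+
  obtain o' where "\<forall>y. y \<noteq> o' \<and> p o' y > 0 \<longrightarrow> ollivier_curvature p d o' y > 0"
    using assms(6) by blast
  then have pos: "0 < ollivier_curvature p d o' y" if "adj p o' y" for y
    using that by (auto simp: adj_def)
  have sub: "im_coboundary0 p \<subseteq> ker_coboundary1 p d"
    using assms(3) by (rule im_coboundary0_subset_ker_coboundary1)
  moreover have "ker_coboundary1 p d \<subseteq> im_coboundary0 p"
  proof
    fix \<alpha> assume \<alpha>: "\<alpha> \<in> ker_coboundary1 p d"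
    \<comment> \<open>Subtracting \<open>coboundary0 p f\<close> adds the Laplacian of
      \<open>f\<close> to the divergence; this choice of \<open>f\<close> makes the divergence the
      constant \<open>c\<close>.\<close>
    obtain f c where f: "\<And>x. laplacian p f x = - divergence \<alpha> x + c"
      using poisson_solvable_mod_constants[of "\<lambda>x. - divergence \<alpha> x"] by blast
    have "\<alpha> - coboundary0 p f = 0"
    proof (rule harmonic_form_eq_0[OF assms(5) pos])
      show "\<alpha> - coboundary0 p f \<in> ker_coboundary1 p d"
        by (intro subspace_diff subspace_ker_coboundary1 \<alpha> coboundary0_in_ker)
      show "divergence (\<alpha> - coboundary0 p f) x = c" for x
        by (simp add: divergence_diff divergence_coboundary0 f)
    qed
    then show "\<alpha> \<in> im_coboundary0 p" by (simp add: im_coboundary0_def)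
  qed
  ultimately have "ker_coboundary1 p d = im_coboundary0 p" by blast
  then show ?thesis
    using quotient_dim_eq[OF subspace_ker_coboundary1[of p d] subspace_im_coboundary0[of p] sub]
    by (simp add: betti1_def)
qed

end
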